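(* Let $\mathbb{X}$ be a real Banach space and $\mathcal{B}=(e_n)_{n=1}^\infty$ a semi-normalized Schauder basis of $\mathbb{X}$. (i) If there exists $C>0$ such that $\|x-\mathcal{G}_m(x)\|\le C\,\mathcal{D}^*_m(x)$ for all $x\in\mathbb{X}$ and all $m\in\mathbb{N}$, then $\mathcal{B}$ has Property $(Q^* )$ with constant $C$. (ii) If $\mathcal{B}$ has Property $(Q^* )$ with constant $C$, then $\|x-\mathcal{G}_m(x)\|\le C^2\sigma_m(x)$ for all $x\in\mathbb{X}$ and all $m\in\mathbb{N}$.
   Context: Setting: $\mathbb{X}$ is a real Banach space and $\mathcal{B}=(e_n)_{n=1}^\infty$ is a Schauder basis of $\mathbb{X}$ with biorthogonal functionals $(e_n^* )$, semi-normalized: $0<\inf_n\|e_n\|\le\sup_n\|e_n\|<\infty$. Here $\mathbb{N}=\{1,2,\dots\}$. Notation: $\mathrm{supp}(x)=\{n: e_n^*(x)\ne0\}$; $\mathbb{X}_c$ is the set of $x\in\mathbb{X}$ with finite support; $\|\tilde x\|_\infty=\sup_n|e_n^*(x)|$; $xy=0$ means $\mathrm{supp}(x)\cap\mathrm{supp}(y)=\emptyset$; $|A|$ is the cardinality of $A$. For finite $A\subset\mathbb{N}$ and signs $\varepsilon=(\varepsilon_n)_{n\in A}\in\{\pm1\}^A$, $1_{\varepsilon A}=\sum_{n\in A}\varepsilon_ne_n$; $[\,\cdot\,]$ denotes linear span and $d(x,V)=\inf_{v\in V}\|x-v\|$. Greedy sums: the natural greedy ordering of $x$ is the injective map $\rho:\mathbb{N}\to\mathbb{N}$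 with $\mathrm{supp}(x)\subset\rho(\mathbb{N})$ such that if $j<k$ then either $|e^*_{\rho(j)}(x)|>|e^*_{\rho(k)}(x)|$, or $|e^*_{\rho(j)}(x)|=|e^*_{\rho(k)}(x)|$ and $\rho(j)<\rho(k)$; and $\mathcal{G}_m(x)=\sum_{j=1}^m e^*_{\rho(j)}(x)e_{\rho(j)}$. Errors: $\sigma_m(x)=\inf\{d(x,[e_n,n\in A]): A\subset\mathbb{N},|A|=m\}$; $\mathcal{D}^*_m(x)=\inf\{d(x,[1_{\varepsilon A}]): \varepsilon\in\{\pm1\}^A, A\subset\mathbb{N},|A|=m\}$. For $z\in\mathbb{X}_c$ let $\Gamma_0=\mathbb{X}_c$ and, for $z\neq0$, $\Gamma_z=\{y\in\mathbb{X}_c: zy=0,\ |\mathrm{supp}(z)|\le|\{n:|e_n^*(y)|=1\}|\}$. Property $(Q^* )$ with constant $C$: $\|x+z\|\le C\|x+y\|$ for all $x,z,y\in\mathbb{X}_c$ with $xz=0$, $xy=0$, $\max\{\|\tilde x\|_\infty,\|\tilde z\|_\infty\}\le1$ and $y\in\Gamma_z$. *)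

theory Defs imports "HOL-Analysis.Analysis" begin

text \<open>
  Basis vectors are indexed by \<^typ>\<open>nat\<close> starting at 0: \<open>e n\<close> is the \<open>(n+1)\<close>-st
  vector of the basis. Only the order of the indices matters below.
\<close>

definition schauder_basis :: "(nat \<Rightarrow> 'a::banach) \<Rightarrow> bool" where
  "schauder_basis e \<longleftrightarrow> (\<forall>x. \<exists>!a::nat \<Rightarrow> real. (\<lambda>n. a n *\<^sub>R e n) sums x)"

definition semi_normalized :: "(nat \<Rightarrow> 'a::real_normed_vector) \<Rightarrow> bool" where
  "semi_normalized e \<longleftrightarrow>
     0 < (INF n. norm (e n)) \<and> bdd_above (range (\<lambda>n. norm (e n)))"

text \<open>
  The biorthogonal functional \<open>e\<^sub>n\<^sup>*\<close> of a Schauder basis: the \<open>n\<close>-th coefficient of the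
  unique expansion of \<open>x\<close>.
\<close>

definition coord :: "(nat \<Rightarrow> 'a::banach) \<Rightarrow> nat \<Rightarrow> 'a \<Rightarrow> real" where
  "coord e n x = (THE a. (\<lambda>k. a k *\<^sub>R e k) sums x) n"

definition supp :: "(nat \<Rightarrow> 'a::banach) \<Rightarrow> 'a \<Rightarrow> nat set" where
  "supp e x = {n. coord e n x \<noteq> 0}"

definition finitely_supported :: "(nat \<Rightarrow> 'a::banach) \<Rightarrow> 'a set" where
  "finitely_supported e = {x. finite (supp e x)}"

definition coord_sup :: "(nat \<Rightarrow> 'a::banach) \<Rightarrow> 'a \<Rightarrow> real" where
  "coord_sup e x = (SUP n. \<bar>coord e n x\<bar>)"

definition disjoint_supp :: "(nat \<Rightarrow> 'a::banach) \<Rightarrow> 'a \<Rightarrow> 'a \<Rightarrow> bool" where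
  "disjoint_supp e x y \<longleftrightarrow> supp e x \<inter> supp e y = {}"

definition natural_greedy_ordering ::
    "(nat \<Rightarrow> 'a::banach) \<Rightarrow> 'a \<Rightarrow> (nat \<Rightarrow> nat) \<Rightarrow> bool" where
  "natural_greedy_ordering e x \<rho> \<longleftrightarrow>
     inj \<rho> \<and> supp e x \<subseteq> range \<rho> \<and>
     (\<forall>j k. j < k \<longrightarrow>
        \<bar>coord e (\<rho> j) x\<bar> > \<bar>coord e (\<rho> k) x\<bar> \<or>
        \<bar>coord e (\<rho> j) x\<bar> = \<bar>coord e (\<rho> k) x\<bar> \<and> \<rho> j < \<rho> k)"

text \<open>
  For a semi-normalized Schauder basis the coefficients tend to 0, so a natural greedy
  ordering exists. It is unique if \<open>supp e x\<close> is infinite; otherwise two such orderings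
  differ only after the support is exhausted, where the terms of the greedy sum vanish.
  Hence the greedy sum does not depend on the choice made by \<open>SOME\<close>.
\<close>

definition greedy_sum :: "(nat \<Rightarrow> 'a::banach) \<Rightarrow> nat \<Rightarrow> 'a \<Rightarrow> 'a" where
  "greedy_sum e m x =
     (let \<rho> = (SOME \<rho>. natural_greedy_ordering e x \<rho>)
      in \<Sum>j<m. coord e (\<rho> j) x *\<^sub>R e (\<rho> j))"

definition signed_sum :: "(nat \<Rightarrow> 'a::banach) \<Rightarrow> (nat \<Rightarrow> real) \<Rightarrow> nat set \<Rightarrow> 'a" where
  "signed_sum e \<epsilon> A = (\<Sum>n\<in>A. \<epsilon> n *\<^sub>R e n)"

definition sigma_error :: "(nat \<Rightarrow> 'a::banach) \<Rightarrow> nat \<Rightarrow> 'a \<Rightarrow> real" where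
  "sigma_error e m x = Inf {infdist x (span (e ` A)) |A. finite A \<and> card A = m}"

definition D_star_error :: "(nat \<Rightarrow> 'a::banach) \<Rightarrow> nat \<Rightarrow> 'a \<Rightarrow> real" where
  "D_star_error e m x =
     Inf {infdist x (span {signed_sum e \<epsilon> A}) |\<epsilon> A.
            (\<forall>n\<in>A. \<epsilon> n \<in> {1, -1}) \<and> finite A \<and> card A = m}"

definition Gamma_set :: "(nat \<Rightarrow> 'a::banach) \<Rightarrow> 'a \<Rightarrow> 'a set" where
  "Gamma_set e z =
     (if z = 0 then finitely_supported e
      else {y \<in> finitely_supported e. disjoint_supp e z y \<and>
              card (supp e z) \<le> card {n. \<bar>coord e n y\<bar> = 1}})"

definition property_Q_star :: "(nat \<Rightarrow> 'a::banach) \<Rightarrow> real \<Rightarrow> bool" where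
  "property_Q_star e C \<longleftrightarrow>
     (\<forall>x \<in> finitely_supported e. \<forall>z \<in> finitely_supported e. \<forall>y \<in> finitely_supported e.
        disjoint_supp e x z \<longrightarrow> disjoint_supp e x y \<longrightarrow>
        max (coord_sup e x) (coord_sup e z) \<le> 1 \<longrightarrow> y \<in> Gamma_set e z \<longrightarrow>
        norm (x + z) \<le> C * norm (x + y))"

end

theory Submission imports Defs begin

text \<open>
  (i) By convexity \<open>z\<close> may be replaced by a signed sum \<open>1\<^bsub>\<eta>B\<^esub>\<close>. Let \<open>S\<close> be a finite set
  containing \<open>supp y\<close>, let \<open>T \<subseteq> S\<close> have as many elements as \<open>B\<close> with \<open>\<bar>y\<bar> = 1\<close> on \<open>T\<close>, and let
  \<open>\<epsilon>\<close> be the signs of \<open>y\<close>. For \<open>\<delta> > 0\<close> the vector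
  \<open>u = x + 1\<^bsub>\<eta>B\<^esub> + y + 1\<^bsub>\<epsilon>(S-T)\<^esub> + \<delta> 1\<^bsub>\<epsilon>S\<^esub>\<close> has \<open>S\<close> as its greedy set of cardinality \<open>\<bar>S\<bar>\<close>, with
  remainder \<open>x + 1\<^bsub>\<eta>B\<^esub>\<close>, while subtracting the signed sum \<open>1\<^bsub>\<eta>B\<^esub> + 1\<^bsub>\<epsilon>(S-T)\<^esub>\<close> of the same
  length from \<open>u\<close> leaves \<open>x + y + \<delta> 1\<^bsub>\<epsilon>S\<^esub>\<close>. Then let \<open>\<delta> \<rightarrow> 0\<close>.

  (ii) Let \<open>G\<close> be the greedy set of \<open>x\<close>, let \<open>t\<close> be the least modulus of a coefficient on \<open>G\<close>, and let
  \<open>w\<close> be supported in \<open>A\<close> with \<open>\<bar>A\<bar> = \<bar>G\<bar>\<close>. The property replaces the part of \<open>x\<close> on \<open>A - G\<close> by \<open>t\<close>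
  times the signs of \<open>x\<close> on \<open>G - A\<close>, at the cost of a factor \<open>C\<close>. By convexity the coefficients
  of that vector on \<open>G - A\<close> may be taken to be \<open>0\<close> or those of \<open>x\<close>, so that it becomes a coordinate
  projection of \<open>x - w\<close>; the case \<open>z = 0\<close> of the property bounds such projections by \<open>C\<close>. Working
  with partial sums of \<open>x\<close> reduces everything to finite supports.
\<close>

section \<open>Coordinates with respect to a Schauder basis\<close>

text \<open>The coefficient function is total although only its values on \<open>F\<close> count;
  this lets one function serve several index sets.\<close>

definition lincomb :: "(nat \<Rightarrow> 'a::banach) \<Rightarrow> (nat \<Rightarrow> real) \<Rightarrow> nat set \<Rightarrow> 'a" where
  "lincomb e c F = (\<Sum>n\<in>F. c n *\<^sub>R e n)"

lemma coord_eqI: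
  assumes "schauder_basis e" "(\<lambda>k. a k *\<^sub>R e k) sums x"
  shows "coord e n x = a n"
proof -
  have "\<exists>!a. (\<lambda>k. a k *\<^sub>R e k) sums x"
    using assms(1) unfolding schauder_basis_def by blast
  then have "(THE a. (\<lambda>k. a k *\<^sub>R e k) sums x) = a"
    using assms(2) by (intro the1_equality)
  then show ?thesis unfolding coord_def by simp
qed

lemma coord_sums:
  assumes "schauder_basis e"
  shows "(\<lambda>k. coord e k x *\<^sub>R e k) sums x"
proof -
  have "\<exists>!a. (\<lambda>k. a k *\<^sub>R e k) sums x"
    using assms unfolding schauder_basis_def by blast
  then have "(\<lambda>k. (THE a. (\<lambda>k. a k *\<^sub>R e k) sums x) k *\<^sub>R e k) sums x"
    by (rule theI')
  then show ?thesis unfolding coord_def .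
qed

lemma coord_lincomb:
  assumes "schauder_basis e" "finite F"
  shows "coord e n (lincomb e c F) = (if n \<in> F then c n else 0)"
proof -
  have "(\<lambda>k. if k \<in> F then c k *\<^sub>R e k else 0) sums lincomb e c F"
    unfolding lincomb_def by (rule sums_If_finite_set[OF assms(2)])
  moreover have "(\<lambda>k. if k \<in> F then c k *\<^sub>R e k else 0)
      = (\<lambda>k. (if k \<in> F then c k else 0) *\<^sub>R e k)"
    by (rule ext) simp
  ultimately have "(\<lambda>k. (if k \<in> F then c k else 0) *\<^sub>R e k) sums lincomb e c F"
    by simp
  from coord_eqI[OF assms(1) this] show ?thesis by simp
qed

lemma supp_lincomb:
  assumes "schauder_basis e" "finite F"
  shows "supp e (lincomb e c F) = {n \<in> F. c n \<noteq> 0}"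
  unfolding supp_def using coord_lincomb[OF assms] by auto

lemma lincomb_finitely_supported:
  assumes "schauder_basis e" "finite F"
  shows "lincomb e c F \<in> finitely_supported e"
  unfolding finitely_supported_def using supp_lincomb[OF assms] assms(2) by simp

lemma coord_sup_lincomb_le:
  assumes "schauder_basis e" "finite F" "\<And>n. n \<in> F \<Longrightarrow> \<bar>c n\<bar> \<le> M" "0 \<le> M"
  shows "coord_sup e (lincomb e c F) \<le> M"
  unfolding coord_sup_def by (rule cSUP_least) (auto simp: coord_lincomb[OF assms(1,2)] assms)

lemma finitely_supported_eq_lincomb:
  assumes "schauder_basis e" "finite F" "supp e x \<subseteq> F"
  shows "x = lincomb e (\<lambda>n. coord e n x) F"
proof -
  have "(\<lambda>k. coord e k x *\<^sub>R e k) sums (\<Sum>k\<in>F. coord e k x *\<^sub>R e k)"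
    by (rule sums_finite[OF assms(2)]) (use assms(3) in \<open>auto simp: supp_def\<close>)
  with coord_sums[OF assms(1)] show ?thesis
    unfolding lincomb_def by (rule sums_unique2)
qed

lemma abs_coord_le_coord_sup:
  assumes "schauder_basis e" "x \<in> finitely_supported e"
  shows "\<bar>coord e n x\<bar> \<le> coord_sup e x"
proof -
  have "range (\<lambda>n. \<bar>coord e n x\<bar>) \<subseteq> insert 0 ((\<lambda>n. \<bar>coord e n x\<bar>) ` supp e x)"
    unfolding supp_def by auto
  then have "finite (range (\<lambda>n. \<bar>coord e n x\<bar>))"
    by (rule finite_subset) (use assms(2) in \<open>simp add: finitely_supported_def\<close>)
  then show ?thesis
    unfolding coord_sup_def by (intro cSUP_upper) auto
qed

text \<open>The terms of a convergent series tend to 0, and dividing by the positive lower bound of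
  \<open>norm (e n)\<close> passes this on to the coefficients.\<close>

lemma coord_tendsto_0:
  assumes "schauder_basis e" "semi_normalized e"
  shows "(\<lambda>n. coord e n x) \<longlonglongrightarrow> 0"
proof -
  define b where "b = (INF n. norm (e n))"
  have b: "0 < b" "\<And>n. b \<le> norm (e n)"
    using assms(2) unfolding semi_normalized_def b_def
    by (auto intro!: cINF_lower bdd_belowI[where m = 0])
  have lim: "(\<lambda>n. norm (coord e n x *\<^sub>R e n) / b) \<longlonglongrightarrow> 0"
    using tendsto_divide[OF tendsto_norm[OF summable_LIMSEQ_zero[OF sums_summable[OF coord_sums[OF assms(1)]]]]
        tendsto_const[of b]] b(1) by simp
  show ?thesis
  proof (rule Lim_null_comparison[OF _ lim])
    show "\<forall>\<^sub>F n in sequentially. norm (coord e n x) \<le> norm (coord e n x *\<^sub>R e n) / b"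
      using b by (intro always_eventually allI) (simp add: pos_le_divide_eq mult_left_mono)
  qed
qed

section \<open>Greedy sums\<close>

text \<open>Each index is ranked by the number of indices that precede it; this number is finite
  because the coefficients tend to 0. Listing the indices by increasing rank gives the
  ordering.\<close>

lemma natural_greedy_ordering_exists:
  fixes e :: "nat \<Rightarrow> 'a::banach"
  assumes "schauder_basis e" "semi_normalized e"
  shows "\<exists>\<rho>. natural_greedy_ordering e x \<rho>"
proof -
  define a where "a n = \<bar>coord e n x\<bar>" for n
  define before where "before j k \<longleftrightarrow> a j > a k \<or> a j = a k \<and> j < k" for j k
  \<comment> \<open>The ordering is an injection of all of \<open>nat\<close>, so a finite support
    is filled up with indices of coefficient 0. If the support is infinite, such an index would have
    infinitely many predecessors and is left out.\<close>
  define S where "S = (if finite (supp e x) then UNIV else supp e x)"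
  have infS: "infinite S" unfolding S_def by auto
  have suppS: "supp e x \<subseteq> S" unfolding S_def by auto
  define r where "r k = card {j \<in> S. before j k}" for k
  have fin: "finite {j \<in> S. before j k}" if "k \<in> S" for k
  proof (cases "a k = 0")
    case True
    then have "finite (supp e x)"
      using that unfolding S_def a_def supp_def by (auto split: if_splits)
    moreover have "{j \<in> S. before j k} \<subseteq> supp e x \<union> {..<k}"
      using True unfolding before_def a_def supp_def by auto
    ultimately show ?thesis by (meson finite_Un finite_lessThan finite_subset)
  next
    case False
    then have "a k > 0" unfolding a_def by simp
    then have "\<forall>\<^sub>F n in sequentially. a n < a k"
      using order_tendstoD(2)[OF tendsto_rabs_zero[OF coord_tendsto_0[OF assms]]] unfolding a_def
      by blast
    then obtain N where "\<And>n. n \<ge> N \<Longrightarrow> a n < a k"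
      unfolding eventually_sequentially by blast
    then have "{j \<in> S. before j k} \<subseteq> {..<N}"
      unfolding before_def by (force simp: not_less[symmetric])
    then show ?thesis by (rule finite_subset) simp
  qed
  have mono: "r j < r k" if "before j k" "j \<in> S" "k \<in> S" for j k
    unfolding r_def
    by (rule psubset_card_mono[OF fin[OF that(3)]]) (use that in \<open>auto simp: before_def\<close>)
  have total: "before j k \<or> j = k \<or> before k j" for j k
    unfolding before_def by auto
  have inj: "inj_on r S"
    by (rule inj_onI) (metis mono total less_irrefl)
  define R where "R = r ` S"
  have infR: "infinite R" unfolding R_def using infS inj by (simp add: finite_image_iff)
  define \<rho> where "\<rho> n = the_inv_into S r (enumerate R n)" for n
  have \<rho>S: "\<rho> n \<in> S" and r\<rho>: "r (\<rho> n) = enumerate R n" for n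
    using enumerate_in_set[OF infR, of n] inj unfolding \<rho>_def R_def
    by (auto intro: the_inv_into_into f_the_inv_into_f)
  have ordered: "before (\<rho> j) (\<rho> k)" if "j < k" for j k
  proof -
    have "r (\<rho> j) < r (\<rho> k)"
      unfolding r\<rho> using enumerate_mono[OF that infR] .
    then show ?thesis using total mono \<rho>S by (metis less_asym less_irrefl)
  qed
  have "inj \<rho>"
    by (rule injI) (metis ordered before_def linorder_neqE_nat less_irrefl)
  moreover have "S \<subseteq> range \<rho>"
  proof
    fix s assume "s \<in> S"
    then obtain n where "enumerate R n = r s"
      using enumerate_Ex[OF infR, of "r s"] unfolding R_def by blast
    then show "s \<in> range \<rho>"
      using inj_onD[OF inj _ \<rho>S \<open>s \<in> S\<close>, of n] r\<rho>[of n] by (metis rangeI)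
  qed
  ultimately have "natural_greedy_ordering e x \<rho>"
    using ordered suppS unfolding natural_greedy_ordering_def before_def a_def by blast
  then show ?thesis by blast
qed

text \<open>An index outside the first \<open>m\<close> either comes later in the ordering or lies
  outside its range, where the coefficient is 0. All later arguments reach the greedy sum through
  this description.\<close>

lemma greedy_sumE:
  fixes e :: "nat \<Rightarrow> 'a::banach"
  assumes "schauder_basis e" "semi_normalized e"
  obtains G where "finite G" "card G = m" "greedy_sum e m x = lincomb e (\<lambda>n. coord e n x) G"
    "\<And>i j. i \<in> G \<Longrightarrow> j \<notin> G \<Longrightarrow> \<bar>coord e j x\<bar> \<le> \<bar>coord e i x\<bar>"
proof -
  define \<rho> where "\<rho> = (SOME \<rho>. natural_greedy_ordering e x \<rho>)"
  have "natural_greedy_ordering e x \<rho>"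
    unfolding \<rho>_def by (rule someI_ex[OF natural_greedy_ordering_exists[OF assms]])
  then have \<rho>: "inj \<rho>" "supp e x \<subseteq> range \<rho>"
    "\<And>j k. j < k \<Longrightarrow> \<bar>coord e (\<rho> k) x\<bar> \<le> \<bar>coord e (\<rho> j) x\<bar>"
    unfolding natural_greedy_ordering_def by (blast, blast, fastforce)
  have inj: "inj_on \<rho> {..<m}" using \<rho>(1) by (rule inj_on_subset) simp
  show ?thesis
  proof (rule that)
    show "finite (\<rho> ` {..<m})" by simp
    show "card (\<rho> ` {..<m}) = m" using inj by (simp add: card_image)
    show "greedy_sum e m x = lincomb e (\<lambda>n. coord e n x) (\<rho> ` {..<m})"
      unfolding greedy_sum_def lincomb_def \<rho>_def[symmetric] Let_def
      by (simp add: sum.reindex[OF inj])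
    fix i j assume i: "i \<in> \<rho> ` {..<m}" and j: "j \<notin> \<rho> ` {..<m}"
    show "\<bar>coord e j x\<bar> \<le> \<bar>coord e i x\<bar>"
    proof (cases "j \<in> range \<rho>")
      case True
      then obtain q where q: "j = \<rho> q" by blast
      obtain p where p: "i = \<rho> p" "p < m" using i by blast
      have "m \<le> q" using j q by (simp add: not_less[symmetric]) blast
      with p q \<rho>(3)[of p q] show ?thesis by simp
    next
      case False
      then have "coord e j x = 0" using \<rho>(2) unfolding supp_def by blast
      then show ?thesis by simp
    qed
  qed
qed

text \<open>A strict gap excludes ties: a different greedy set of the same cardinality would contain
  an index outside \<open>S\<close> and miss one of \<open>S\<close>, against the gap.\<close>

lemma greedy_sum_eqI:
  fixes e :: "nat \<Rightarrow> 'a::banach"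
  assumes "schauder_basis e" "semi_normalized e" "finite S"
    and gt: "\<And>i j. i \<in> S \<Longrightarrow> j \<notin> S \<Longrightarrow> \<bar>coord e j x\<bar> < \<bar>coord e i x\<bar>"
  shows "greedy_sum e (card S) x = lincomb e (\<lambda>n. coord e n x) S"
proof -
  obtain G where G: "finite G" "card G = card S"
    "greedy_sum e (card S) x = lincomb e (\<lambda>n. coord e n x) G"
    "\<And>i j. i \<in> G \<Longrightarrow> j \<notin> G \<Longrightarrow> \<bar>coord e j x\<bar> \<le> \<bar>coord e i x\<bar>"
    using greedy_sumE[OF assms(1,2)] by metis
  have "G \<subseteq> S"
  proof (rule ccontr)
    assume "\<not> G \<subseteq> S"
    moreover have "\<not> S \<subseteq> G"
    proof
      assume "S \<subseteq> G"
      then have "S = G" by (rule card_subset_eq[OF G(1)]) (simp add: G(2))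
      with \<open>\<not> G \<subseteq> S\<close> show False by simp
    qed
    ultimately obtain i j where "i \<in> G" "i \<notin> S" "j \<in> S" "j \<notin> G" by blast
    with gt[of j i] G(4)[of i j] show False by simp
  qed
  then have "G = S" using card_subset_eq[OF assms(3)] G(2) by blast
  with G(3) show ?thesis by simp
qed

section \<open>Convexity\<close>

text \<open>The norm is convex in each summand separately, so its bound at the extreme choices
  extends to the hulls, one summand at a time.\<close>

lemma norm_add_sum_convex_hull_le:
  fixes v :: "'a::real_normed_vector"
  assumes "finite D"
    and "\<And>f. (\<And>n. n \<in> D \<Longrightarrow> f n \<in> P n) \<Longrightarrow> norm (v + sum f D) \<le> M"
    and "\<And>n. n \<in> D \<Longrightarrow> b n \<in> convex hull (P n)"
  shows "norm (v + sum b D) \<le> M"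
  using assms
proof (induction D arbitrary: v rule: finite_induct)
  case empty
  then show ?case by force
next
  case (insert k D)
  \<comment> \<open>The values allowed for the summand at \<open>k\<close> form a closed ball, which
    is convex; hence it suffices to place the points of \<open>P k\<close> in it.\<close>
  have "P k \<subseteq> cball (- (v + sum b D)) M"
  proof
    fix p assume p: "p \<in> P k"
    have "norm ((v + p) + sum b D) \<le> M"
    proof (rule insert.IH)
      fix f assume f: "\<And>n. n \<in> D \<Longrightarrow> f n \<in> P n"
      have "sum (f(k := p)) D = sum f D"
        by (rule sum.cong) (use insert.hyps in auto)
      moreover have "norm (v + sum (f(k := p)) (insert k D)) \<le> M"
        by (rule insert.prems(1)) (use f p in auto)
      ultimately show "norm (v + p + sum f D) \<le> M"
        using insert.hyps by (simp add: add.assoc)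
    qed (use insert.prems in auto)
    moreover have "- (v + sum b D) - p = - ((v + p) + sum b D)" by simp
    ultimately show "p \<in> cball (- (v + sum b D)) M"
      by (simp only: mem_cball dist_norm norm_minus_cancel)
  qed
  then have "convex hull (P k) \<subseteq> cball (- (v + sum b D)) M"
    by (rule hull_minimal) simp
  then have "b k \<in> cball (- (v + sum b D)) M"
    using insert.prems(2)[of k] by blast
  moreover have "- (v + sum b D) - b k = - (v + sum b D + b k)" by simp
  ultimately have "norm (v + sum b D + b k) \<le> M"
    by (simp only: mem_cball dist_norm norm_minus_cancel)
  then show ?case using insert.hyps by (simp add: algebra_simps)
qed

section \<open>From the greedy estimate to the property\<close>

lemma D_star_error_le:
  assumes "finite A" "\<And>n. n \<in> A \<Longrightarrow> \<epsilon> n \<in> {1, -1}"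
  shows "D_star_error e (card A) x \<le> norm (x - lincomb e \<epsilon> A)"
proof -
  have "D_star_error e (card A) x \<le> infdist x (span {signed_sum e \<epsilon> A})"
    unfolding D_star_error_def
    by (rule cInf_lower) (use assms in \<open>auto intro!: bdd_belowI[where m = 0] simp: infdist_nonneg\<close>)
  also have "\<dots> \<le> dist x (signed_sum e \<epsilon> A)"
    by (rule infdist_le) (simp add: span_base)
  finally show ?thesis unfolding dist_norm signed_sum_def lincomb_def .
qed

lemma greedy_signed_estimate:
  fixes e :: "nat \<Rightarrow> 'a::banach"
  assumes basis: "schauder_basis e" "semi_normalized e" and "C > 0"
    and greedy: "\<And>x m. m \<ge> 1 \<Longrightarrow> norm (x - greedy_sum e m x) \<le> C * D_star_error e m x"
    and fin: "finite F" "finite B" "finite S" and "S \<noteq> {}"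
    and disj: "F \<inter> B = {}" "F \<inter> S = {}" "B \<inter> S = {}"
    and le: "\<And>n. n \<in> F \<Longrightarrow> \<bar>a n\<bar> \<le> 1" and sgn: "\<And>n. n \<in> B \<Longrightarrow> \<eta> n \<in> {1, -1}"
    and T: "T \<subseteq> S" "card T = card B" "\<And>n. n \<in> T \<Longrightarrow> \<bar>c n\<bar> = 1"
  shows "norm (lincomb e a F + lincomb e \<eta> B) \<le> C * norm (lincomb e a F + lincomb e c S)"
proof -
  \<comment> \<open>The value at a zero coefficient is 1 and not 0, so that \<epsilon> is a genuine
    sign on all of \<open>S\<close>.\<close>
  define \<epsilon> where "\<epsilon> n = (if c n \<ge> 0 then 1 else -1::real)" for n
  have perturbed: "norm (lincomb e a F + lincomb e \<eta> B)
      \<le> C * norm (lincomb e a F + lincomb e c S) + \<delta> * (C * norm (lincomb e \<epsilon> S))"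
    if "\<delta> > 0" for \<delta>
  proof -
    \<comment> \<open>\<open>T\<close> is exchanged for \<open>B\<close>, which keeps the
      cardinality of \<open>S\<close>.\<close>
    define A where "A = B \<union> (S - T)"
    define sg where "sg n = (if n \<in> B then \<eta> n else \<epsilon> n)" for n
    \<comment> \<open>On \<open>T\<close> the modulus is 1 + \<delta>, on the rest of
      \<open>S\<close> it is 1 + \<delta> plus that of \<open>c n\<close>, and elsewhere it is at
      most 1.\<close>
    define w where "w n = (if n \<in> F then a n else if n \<in> B then \<eta> n
        else c n + \<delta> * \<epsilon> n + (if n \<in> T then 0 else \<epsilon> n))" for n
    define u where "u = lincomb e w (F \<union> B \<union> S)"
    have coord_u: "coord e n u = (if n \<in> F \<union> B \<union> S then w n else 0)" for n
      unfolding u_def using fin by (simp add: coord_lincomb[OF basis(1)])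
    have cardA: "card A = card S"
    proof -
      have "card A = card B + card (S - T)"
        unfolding A_def by (rule card_Un_disjoint) (use fin disj in auto)
      also have "card (S - T) = card S - card T"
        using T(1) fin by (simp add: card_Diff_subset finite_subset)
      finally show ?thesis using T(2) card_mono[OF fin(3) T(1)] by simp
    qed
    have big: "1 < \<bar>w n\<bar>" if "n \<in> S" for n
    proof -
      have "w n = c n + \<delta> * \<epsilon> n + (if n \<in> T then 0 else \<epsilon> n)"
        using that disj unfolding w_def by auto
      then show ?thesis using T(3)[of n] \<open>\<delta> > 0\<close> unfolding \<epsilon>_def
        by (auto split: if_splits)
    qed
    have small: "\<bar>coord e n u\<bar> \<le> 1" if "n \<notin> S" for n
      using that le[of n] sgn[of n] unfolding coord_u w_def by auto
    have "greedy_sum e (card S) u = lincomb e (\<lambda>n. coord e n u) S"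
    proof (rule greedy_sum_eqI[OF basis fin(3)])
      fix i j assume "i \<in> S" "j \<notin> S"
      then show "\<bar>coord e j u\<bar> < \<bar>coord e i u\<bar>"
        using big[of i] small[of j] by (simp add: coord_u[of i])
    qed
    also have "\<dots> = lincomb e w S"
      unfolding lincomb_def by (rule sum.cong) (auto simp: coord_u)
    finally have g: "greedy_sum e (card S) u = lincomb e w S" .
    have split: "u = lincomb e a F + lincomb e \<eta> B + lincomb e w S"
    proof -
      have "u = lincomb e w F + lincomb e w B + lincomb e w S"
        unfolding u_def lincomb_def
        using fin disj by (simp add: sum.union_disjoint Int_Un_distrib2)
      moreover have "lincomb e w F = lincomb e a F"
        unfolding lincomb_def by (rule sum.cong) (auto simp: w_def)
      moreover have "lincomb e w B = lincomb e \<eta> B"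
        unfolding lincomb_def by (rule sum.cong) (use disj in \<open>auto simp: w_def\<close>)
      ultimately show ?thesis by simp
    qed
    have wS: "lincomb e w S = lincomb e c S + \<delta> *\<^sub>R lincomb e \<epsilon> S + lincomb e sg (S - T)"
    proof -
      have "lincomb e sg (S - T) = (\<Sum>n\<in>S. if n \<in> T then 0 else \<epsilon> n *\<^sub>R e n)"
        unfolding lincomb_def
        by (rule sum.mono_neutral_cong_left) (use fin disj in \<open>auto simp: sg_def\<close>)
      moreover have "lincomb e w S = (\<Sum>n\<in>S. c n *\<^sub>R e n + (\<delta> * \<epsilon> n) *\<^sub>R e n
          + (if n \<in> T then 0 else \<epsilon> n *\<^sub>R e n))"
        unfolding lincomb_def
        by (rule sum.cong) (use disj in \<open>auto simp: w_def scaleR_add_left\<close>)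
      ultimately show ?thesis
        unfolding lincomb_def by (simp add: sum.distrib scaleR_sum_right)
    qed
    have sgA: "lincomb e sg A = lincomb e \<eta> B + lincomb e sg (S - T)"
    proof -
      have "lincomb e sg A = lincomb e sg B + lincomb e sg (S - T)"
        unfolding A_def lincomb_def by (rule sum.union_disjoint) (use fin disj in auto)
      moreover have "lincomb e sg B = lincomb e \<eta> B"
        unfolding lincomb_def by (rule sum.cong) (auto simp: sg_def)
      ultimately show ?thesis by simp
    qed
    have "card S \<ge> 1"
      using fin(3) \<open>S \<noteq> {}\<close> by (simp add: Suc_le_eq card_gt_0_iff)
    have "norm (lincomb e a F + lincomb e \<eta> B) = norm (u - greedy_sum e (card S) u)"
      unfolding g by (simp add: split)
    also have "\<dots> \<le> C * D_star_error e (card A) u"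
      using greedy[OF \<open>card S \<ge> 1\<close>, of u] cardA by simp
    also have "\<dots> \<le> C * norm (u - lincomb e sg A)"
    proof (intro mult_left_mono D_star_error_le)
      show "finite A" unfolding A_def using fin by simp
      show "sg n \<in> {1, -1}" if "n \<in> A" for n
        using sgn[of n] unfolding sg_def \<epsilon>_def by auto
    qed (use \<open>C > 0\<close> in simp)
    \<comment> \<open>The signed sums over \<open>B\<close> and over \<open>S - T\<close> both
      cancel.\<close>
    also have "u - lincomb e sg A = (lincomb e a F + lincomb e c S) + \<delta> *\<^sub>R lincomb e \<epsilon> S"
      unfolding split sgA wS by simp
    also have "C * norm \<dots> \<le> C * (norm (lincomb e a F + lincomb e c S) + norm (\<delta> *\<^sub>R lincomb e \<epsilon> S))"
      using \<open>C > 0\<close> by (intro mult_left_mono norm_triangle_ineq) simp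
    finally show ?thesis using \<open>\<delta> > 0\<close> by (simp add: algebra_simps)
  qed
  show ?thesis
  proof (rule tendsto_lowerbound)
    show "((\<lambda>\<delta>. C * norm (lincomb e a F + lincomb e c S) + \<delta> * (C * norm (lincomb e \<epsilon> S)))
        \<longlongrightarrow> C * norm (lincomb e a F + lincomb e c S)) (at_right 0)"
      by (auto intro!: tendsto_eq_intros)
    show "\<forall>\<^sub>F \<delta> in at_right 0. norm (lincomb e a F + lincomb e \<eta> B)
        \<le> C * norm (lincomb e a F + lincomb e c S) + \<delta> * (C * norm (lincomb e \<epsilon> S))"
      using perturbed eventually_at_right_less[of 0] by (auto elim: eventually_mono)
  qed simp
qed

lemma greedy_imp_property_Q_star:
  fixes e :: "nat \<Rightarrow> 'a::banach"
  assumes basis: "schauder_basis e" "semi_normalized e" and "C > 0"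
    and greedy: "\<And>x m. m \<ge> 1 \<Longrightarrow> norm (x - greedy_sum e m x) \<le> C * D_star_error e m x"
  shows "property_Q_star e C"
  unfolding property_Q_star_def
proof (intro ballI impI)
  fix x z y
  assume fs: "x \<in> finitely_supported e" "z \<in> finitely_supported e" "y \<in> finitely_supported e"
    and disj: "disjoint_supp e x z" "disjoint_supp e x y"
    and sup: "max (coord_sup e x) (coord_sup e z) \<le> 1" and \<Gamma>: "y \<in> Gamma_set e z"
  define X Z Y where "X = supp e x" and "Z = supp e z" and "Y = supp e y"
  have fin: "finite X" "finite Z" "finite Y"
    using fs unfolding X_def Z_def Y_def finitely_supported_def by auto
  define ones where "ones = {n. \<bar>coord e n y\<bar> = 1}"
  have ones: "ones \<subseteq> Y" unfolding ones_def Y_def supp_def by auto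
  \<comment> \<open>For \<open>z = 0\<close> the disjointness and the cardinality bound hold
    trivially, so both cases of \<open>Gamma_set\<close> can be treated together.\<close>
  have z0: "Z = {}" if "z = 0"
    using that supp_lincomb[OF basis(1) finite.emptyI] unfolding Z_def by (simp add: lincomb_def)
  have XZ: "X \<inter> Z = {}" and XY: "X \<inter> Y = {}"
    using disj unfolding disjoint_supp_def X_def Y_def Z_def by auto
  have ZY: "Z \<inter> Y = {}" and card: "card Z \<le> card ones"
    using \<Gamma> z0 unfolding Gamma_set_def disjoint_supp_def Z_def Y_def ones_def
    by (auto split: if_splits)
  obtain T where T: "T \<subseteq> ones" "card T = card Z"
    using obtain_subset_with_card_n[OF card] by metis
  \<comment> \<open>The fresh index, where \<open>y\<close> has coefficient 0, keeps
    \<open>S\<close> nonempty even for \<open>y = 0\<close>; the greedy estimate is available only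
    for \<open>m \<ge> 1\<close>.\<close>
  obtain k where k: "k \<notin> X \<union> Z \<union> Y"
    using fin by (metis ex_new_if_finite finite_UnI infinite_UNIV_nat)
  define S where "S = insert k Y"
  have S: "finite S" "S \<noteq> {}" "X \<inter> S = {}" "Z \<inter> S = {}" "T \<subseteq> S"
    using fin XY ZY T ones k unfolding S_def by auto
  have ex: "x = lincomb e (\<lambda>n. coord e n x) X"
    by (rule finitely_supported_eq_lincomb[OF basis(1) fin(1)]) (simp add: X_def)
  have ez: "z = lincomb e (\<lambda>n. coord e n z) Z"
    by (rule finitely_supported_eq_lincomb[OF basis(1) fin(2)]) (simp add: Z_def)
  have ey: "y = lincomb e (\<lambda>n. coord e n y) S"
    by (rule finitely_supported_eq_lincomb[OF basis(1) S(1)]) (auto simp: S_def Y_def)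
  have le: "\<bar>coord e n x\<bar> \<le> 1" "\<bar>coord e n z\<bar> \<le> 1" for n
    using abs_coord_le_coord_sup[OF basis(1) fs(1), of n]
      abs_coord_le_coord_sup[OF basis(1) fs(2), of n] sup by auto
  have "norm (x + (\<Sum>n\<in>Z. coord e n z *\<^sub>R e n)) \<le> C * norm (x + y)"
  proof (rule norm_add_sum_convex_hull_le[where P = "\<lambda>n. {e n, - e n}"])
    show "finite Z" by (rule fin)
    show "coord e n z *\<^sub>R e n \<in> convex hull {e n, - e n}" for n
    proof -
      \<comment> \<open>A coefficient in [-1, 1] is a convex combination of the two signs.\<close>
      have "coord e n z *\<^sub>R e n = ((1 + coord e n z) / 2) *\<^sub>R e n + ((1 - coord e n z) / 2) *\<^sub>R (- e n)"
        by (simp add: algebra_simps flip: scaleR_add_left)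
           (simp add: field_simps flip: scaleR_add_left)
      moreover have "0 \<le> (1 + coord e n z) / 2" "0 \<le> (1 - coord e n z) / 2"
        using le(2)[of n] by auto
      moreover have "(1 + coord e n z) / 2 + (1 - coord e n z) / 2 = 1"
        by (simp add: field_simps)
      ultimately show ?thesis unfolding convex_hull_2 by blast
    qed
    fix f assume f: "\<And>n. n \<in> Z \<Longrightarrow> f n \<in> {e n, - e n}"
    define \<eta> where "\<eta> n = (if f n = e n then 1 else -1::real)" for n
    have "sum f Z = lincomb e \<eta> Z"
      unfolding lincomb_def \<eta>_def by (rule sum.cong) (use f in auto)
    moreover have "norm (lincomb e (\<lambda>n. coord e n x) X + lincomb e \<eta> Z)
        \<le> C * norm (lincomb e (\<lambda>n. coord e n x) X + lincomb e (\<lambda>n. coord e n y) S)"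
      using T(1) le(1) S XZ fin T(2)
      by (intro greedy_signed_estimate[OF basis \<open>C > 0\<close> greedy, where T = T])
        (auto simp: \<eta>_def ones_def)
    ultimately show "norm (x + sum f Z) \<le> C * norm (x + y)"
      using ex ey by simp
  qed
  then show "norm (x + z) \<le> C * norm (x + y)"
    using ez unfolding lincomb_def by simp
qed

section \<open>From the property to the greedy estimate\<close>

text \<open>Homogeneity: dividing all vectors by \<open>t\<close> turns the threshold
  \<open>t\<close> into the threshold 1 of the property.\<close>

lemma property_Q_star_lincomb:
  fixes e :: "nat \<Rightarrow> 'a::banach"
  assumes basis: "schauder_basis e" and Q: "property_Q_star e C" and "t > 0"
    and fin: "finite F" "finite B" "finite S"
    and disj: "F \<inter> B = {}" "F \<inter> S = {}" "B \<inter> S = {}"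
    and le: "\<And>n. n \<in> F \<Longrightarrow> \<bar>a n\<bar> \<le> t" "\<And>n. n \<in> B \<Longrightarrow> \<bar>b n\<bar> \<le> t"
    and card: "card B \<le> card {n \<in> S. \<bar>c n\<bar> = t}"
  shows "norm (lincomb e a F + lincomb e b B) \<le> C * norm (lincomb e a F + lincomb e c S)"
proof -
  define L where "L c = lincomb e (\<lambda>n. c n / t)" for c
  have scale: "L c A = inverse t *\<^sub>R lincomb e c A" for c A
    unfolding L_def lincomb_def scaleR_sum_right by (simp add: field_simps)
  have "norm (L a F + L b B) \<le> C * norm (L a F + L c S)"
  proof (rule Q[unfolded property_Q_star_def, rule_format])
    show fs: "L a F \<in> finitely_supported e" "L b B \<in> finitely_supported e" "L c S \<in> finitely_supported e"
      unfolding L_def using fin by (simp_all add: lincomb_finitely_supported[OF basis])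
    show "disjoint_supp e (L a F) (L b B)" "disjoint_supp e (L a F) (L c S)"
      unfolding disjoint_supp_def L_def using disj fin by (auto simp: supp_lincomb[OF basis])
    show "max (coord_sup e (L a F)) (coord_sup e (L b B)) \<le> 1"
      unfolding L_def using fin le \<open>t > 0\<close>
      by (auto intro!: coord_sup_lincomb_le[OF basis])
    have "card (supp e (L b B)) \<le> card B"
      unfolding L_def supp_lincomb[OF basis fin(2)] by (rule card_mono) (use fin in auto)
    also have "{n \<in> S. \<bar>c n\<bar> = t} = {n. \<bar>coord e n (L c S)\<bar> = 1}"
      unfolding L_def coord_lincomb[OF basis fin(3)] using \<open>t > 0\<close> by auto
    note card[unfolded this]
    finally have "card (supp e (L b B)) \<le> card {n. \<bar>coord e n (L c S)\<bar> = 1}" .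
    moreover have "disjoint_supp e (L b B) (L c S)"
      unfolding disjoint_supp_def L_def using disj fin by (auto simp: supp_lincomb[OF basis])
    ultimately show "L c S \<in> Gamma_set e (L b B)"
      unfolding Gamma_set_def using fs by simp
  qed
  then have "norm (inverse t *\<^sub>R (lincomb e a F + lincomb e b B))
      \<le> C * norm (inverse t *\<^sub>R (lincomb e a F + lincomb e c S))"
    unfolding scale scaleR_add_right .
  then have "inverse t * norm (lincomb e a F + lincomb e b B)
      \<le> inverse t * (C * norm (lincomb e a F + lincomb e c S))"
    using \<open>t > 0\<close> by (simp only: norm_scaleR abs_inverse abs_of_pos mult.left_commute)
  then show ?thesis
    using \<open>t > 0\<close> by simp
qed

text \<open>This is the case z = 0, with the discarded part in the role of y. Scaling by a bound for
  the coefficients on \<open>F\<close> removes the restriction on their size.\<close>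

lemma property_Q_star_suppression:
  fixes e :: "nat \<Rightarrow> 'a::banach"
  assumes "schauder_basis e" "property_Q_star e C" "finite S" "F \<subseteq> S"
  shows "norm (lincomb e a F) \<le> C * norm (lincomb e a S)"
proof -
  have fin: "finite F" using assms(3,4) by (rule finite_subset[rotated])
  \<comment> \<open>The summand 1 makes \<open>t\<close> positive even when the sum
    vanishes.\<close>
  define t where "t = 1 + (\<Sum>n\<in>F. \<bar>a n\<bar>)"
  have "t > 0" unfolding t_def by (simp add: add_pos_nonneg sum_nonneg)
  have "\<bar>a n\<bar> \<le> t" if "n \<in> F" for n
    using member_le_sum[OF that, of "\<lambda>n. \<bar>a n\<bar>"] fin unfolding t_def by simp
  then have "norm (lincomb e a F + lincomb e a {})
      \<le> C * norm (lincomb e a F + lincomb e a (S - F))"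
    using assms fin \<open>t > 0\<close> by (intro property_Q_star_lincomb[where t = t]) auto
  moreover have "lincomb e a S = lincomb e a F + lincomb e a (S - F)"
    unfolding lincomb_def using assms(3,4) by (metis add.commute sum.subset_diff)
  ultimately show ?thesis by (simp add: lincomb_def)
qed

text \<open>Suppressing nothing from \<open>e 0\<close>, which is nonzero by uniqueness of
  expansions, already forces the bound. It supplies the sign of \<open>C\<close>, about which the
  second half of the theorem assumes nothing.\<close>

lemma property_Q_star_ge_1:
  fixes e :: "nat \<Rightarrow> 'a::banach"
  assumes "schauder_basis e" "property_Q_star e C"
  shows "1 \<le> C"
proof -
  have "coord e 0 (lincomb e (\<lambda>_. 1) {0}) \<noteq> coord e 0 (lincomb e (\<lambda>_. 0) {0})"
    by (simp add: coord_lincomb[OF assms(1)])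
  then have "e 0 \<noteq> 0" unfolding lincomb_def by auto
  moreover have "norm (e 0) \<le> C * norm (e 0)"
    using property_Q_star_suppression[OF assms, of "{0}" "{0}" "\<lambda>_. 1"]
    by (simp add: lincomb_def)
  ultimately show ?thesis by simp
qed

text \<open>One factor \<open>C\<close> pays for exchanging \<open>A - G\<close> against
  \<open>G - A\<close>, the other for projecting x - w onto part of its coordinates, where w is
  \<open>lincomb e c A\<close>.\<close>

lemma property_Q_star_greedy_finite:
  fixes e :: "nat \<Rightarrow> 'a::banach"
  assumes basis: "schauder_basis e" and Q: "property_Q_star e C"
    and fin: "finite S" and sub: "G \<subseteq> S" "A \<subseteq> S" and card: "card A = card G" and "G \<noteq> {}"
    and greedy: "\<And>i j. i \<in> G \<Longrightarrow> j \<notin> G \<Longrightarrow> \<bar>a j\<bar> \<le> \<bar>a i\<bar>"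
  shows "norm (lincomb e a S - lincomb e a G) \<le> C\<^sup>2 * norm (lincomb e a S - lincomb e c A)"
proof -
  define t where "t = Min ((\<lambda>n. \<bar>a n\<bar>) ` G)"
  have finGA: "finite G" "finite A" using sub fin by (auto intro: finite_subset)
  have t_le: "t \<le> \<bar>a i\<bar>" if "i \<in> G" for i
    unfolding t_def using that finGA by simp
  have "t \<in> (\<lambda>n. \<bar>a n\<bar>) ` G"
    unfolding t_def using finGA \<open>G \<noteq> {}\<close> by (intro Min_in) auto
  then obtain i0 where "i0 \<in> G" "t = \<bar>a i0\<bar>" by blast
  then have le_t: "\<bar>a j\<bar> \<le> t" if "j \<notin> G" for j using greedy that by blast
  have C: "1 \<le> C" by (rule property_Q_star_ge_1[OF basis Q])
  define R where "R = S - (A \<union> G)"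
  have err: "lincomb e a S - lincomb e a G = lincomb e a R + lincomb e a (A - G)"
  proof -
    have "lincomb e a S = lincomb e a G + lincomb e a (S - G)"
      unfolding lincomb_def using sub fin by (metis add.commute sum.subset_diff)
    moreover have "S - G = R \<union> (A - G)" using sub unfolding R_def by auto
    moreover have "lincomb e a (R \<union> (A - G)) = lincomb e a R + lincomb e a (A - G)"
      unfolding lincomb_def by (rule sum.union_disjoint) (use fin finGA in \<open>auto simp: R_def\<close>)
    ultimately show ?thesis by simp
  qed
  show ?thesis
  \<comment> \<open>Scaling needs \<open>t > 0\<close>; if \<open>t = 0\<close>, all coefficients
    off \<open>G\<close> vanish and so does the greedy error.\<close>
  proof (cases "t = 0")
    case True
    then have "lincomb e a R = 0" "lincomb e a (A - G) = 0"
      unfolding lincomb_def using le_t by (auto intro!: sum.neutral simp: R_def)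
    then show ?thesis unfolding err by simp
  next
    case False
    then have "t > 0" using \<open>t = \<bar>a i0\<bar>\<close> by simp
    define D where "D = G - A"
    have cardD: "card (A - G) = card D"
      unfolding D_def using card finGA by (metis card_le_sym_Diff card_less_sym_Diff linorder_not_less order_antisym le_refl)
    have D1: "{n \<in> D. \<bar>t * sgn (a n)\<bar> = t} = D"
      using t_le \<open>t > 0\<close> unfolding D_def by (force simp: abs_mult abs_sgn_eq)
    have "norm (lincomb e a R + lincomb e a (A - G))
        \<le> C * norm (lincomb e a R + lincomb e (\<lambda>n. t * sgn (a n)) D)"
      by (rule property_Q_star_lincomb[OF basis Q \<open>t > 0\<close>, unfolded D1])
        (use fin finGA cardD D1 le_t in \<open>auto simp: R_def D_def\<close>)
    moreover have "norm (lincomb e a R + (\<Sum>n\<in>D. (t * sgn (a n)) *\<^sub>R e n))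
        \<le> C * norm (lincomb e a S - lincomb e c A)"
    proof (rule norm_add_sum_convex_hull_le[where P = "\<lambda>n. {0, a n *\<^sub>R e n}"])
      show "finite D" unfolding D_def using finGA by simp
      show "(t * sgn (a n)) *\<^sub>R e n \<in> convex hull {0, a n *\<^sub>R e n}" if "n \<in> D" for n
      proof -
        have "t \<le> \<bar>a n\<bar>" using that t_le unfolding D_def by simp
        then have l: "0 \<le> t / \<bar>a n\<bar>" "0 \<le> 1 - t / \<bar>a n\<bar>" "a n \<noteq> 0"
          using \<open>t > 0\<close> by auto
        \<comment> \<open>Since \<open>t\<close> is at most the modulus of \<open>a n\<close>, this
          vector lies on the segment from 0 to \<open>a n *\<^sub>R e n\<close>.\<close>
        then have "(t * sgn (a n)) *\<^sub>R e n = (1 - t / \<bar>a n\<bar>) *\<^sub>R 0 + (t / \<bar>a n\<bar>) *\<^sub>R (a n *\<^sub>R e n)"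
          by (simp add: sgn_real_def)
        moreover have "(1 - t / \<bar>a n\<bar>) + t / \<bar>a n\<bar> = 1" by simp
        ultimately show ?thesis using l(1,2) unfolding convex_hull_2 by blast
      qed
      fix f assume f: "\<And>n. n \<in> D \<Longrightarrow> f n \<in> {0, a n *\<^sub>R e n}"
      define E where "E = {n \<in> D. f n \<noteq> 0}"
      \<comment> \<open>These are the coefficients of x - w; they agree with \<open>a\<close> on
        \<open>R \<union> E\<close>, which is disjoint from \<open>A\<close>.\<close>
      define b where "b n = (if n \<in> A then a n - c n else a n)" for n
      have "sum f D = lincomb e a E"
        unfolding lincomb_def
        by (rule sum.mono_neutral_cong_right) (use f \<open>finite D\<close> in \<open>auto simp: E_def\<close>)
      moreover have "lincomb e a R + lincomb e a E = lincomb e b (R \<union> E)"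
      proof -
        have "lincomb e a R + lincomb e a E = lincomb e a (R \<union> E)"
          unfolding lincomb_def
          by (rule sum.union_disjoint[symmetric])
            (use fin finGA in \<open>auto simp: E_def D_def R_def\<close>)
        also have "\<dots> = lincomb e b (R \<union> E)"
          unfolding lincomb_def by (rule sum.cong) (auto simp: b_def R_def E_def D_def)
        finally show ?thesis .
      qed
      moreover have "norm (lincomb e b (R \<union> E)) \<le> C * norm (lincomb e b S)"
        by (rule property_Q_star_suppression[OF basis Q fin])
          (use sub in \<open>auto simp: R_def E_def D_def\<close>)
      moreover have "lincomb e b S = lincomb e a S - lincomb e c A"
      proof -
        have "lincomb e c A = (\<Sum>n\<in>S. if n \<in> A then c n *\<^sub>R e n else 0)"
          unfolding lincomb_def
          by (rule sum.mono_neutral_cong_left) (use fin sub in auto)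
        moreover have "lincomb e b S = (\<Sum>n\<in>S. a n *\<^sub>R e n - (if n \<in> A then c n *\<^sub>R e n else 0))"
          unfolding lincomb_def by (rule sum.cong) (auto simp: b_def algebra_simps)
        ultimately show ?thesis
          unfolding lincomb_def by (simp add: sum_subtractf)
      qed
      ultimately show "norm (lincomb e a R + sum f D) \<le> C * norm (lincomb e a S - lincomb e c A)"
        by simp
    qed
    ultimately have "norm (lincomb e a R + lincomb e a (A - G))
        \<le> C * (C * norm (lincomb e a S - lincomb e c A))"
      using C unfolding lincomb_def
      by (meson mult_left_mono order_trans zero_le_one)
    then show ?thesis unfolding err by (simp add: power2_eq_square mult.assoc)
  qed
qed

lemma span_image_eq_lincomb:
  assumes "finite A" "w \<in> span (e ` A)"
  obtains c where "w = lincomb e c A"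
proof -
  have "\<exists>c. w = lincomb e c A"
    using assms(2)
  proof (induction rule: span_induct_alt)
    case base
    show ?case by (rule exI[of _ "\<lambda>_. 0"]) (simp add: lincomb_def)
  next
    case (step r v w)
    then obtain c k where "w = lincomb e c A" "k \<in> A" "v = e k" by blast
    then have "r *\<^sub>R v + w = lincomb e (\<lambda>n. c n + (if n = k then r else 0)) A"
      unfolding lincomb_def using assms(1)
      by (simp add: scaleR_add_left sum.distrib if_distrib[of "\<lambda>r. r *\<^sub>R _"] cong: if_cong)
    then show ?case by blast
  qed
  then show ?thesis using that by blast
qed

text \<open>Partial sums reaching beyond \<open>G\<close> and \<open>A\<close> have the same
  coefficients there, so \<open>G\<close> stays greedy for them and the finite estimate passes to
  the limit.\<close>

lemma property_Q_star_imp_greedy: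
  fixes e :: "nat \<Rightarrow> 'a::banach"
  assumes basis: "schauder_basis e" "semi_normalized e" and Q: "property_Q_star e C" and "m \<ge> 1"
  shows "norm (x - greedy_sum e m x) \<le> C\<^sup>2 * sigma_error e m x"
proof -
  define a where "a n = coord e n x" for n
  obtain G where G: "finite G" "card G = m" "greedy_sum e m x = lincomb e a G"
    "\<And>i j. i \<in> G \<Longrightarrow> j \<notin> G \<Longrightarrow> \<bar>a j\<bar> \<le> \<bar>a i\<bar>"
    using greedy_sumE[OF basis] unfolding a_def by metis
  have "G \<noteq> {}" using G(2) \<open>m \<ge> 1\<close> by auto
  have "C > 0" using property_Q_star_ge_1[OF basis(1) Q] by simp
  have partial: "(\<lambda>N. lincomb e a {..<N}) \<longlonglongrightarrow> x"
    using coord_sums[OF basis(1), of x] unfolding sums_def lincomb_def a_def .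
  have le: "norm (x - lincomb e a G) \<le> C\<^sup>2 * norm (x - lincomb e c A)"
    if "finite A" "card A = m" for A c
  proof (rule tendsto_le)
    show "(\<lambda>N. C\<^sup>2 * norm (lincomb e a {..<N} - lincomb e c A))
        \<longlonglongrightarrow> C\<^sup>2 * norm (x - lincomb e c A)"
      by (intro tendsto_intros partial)
    show "(\<lambda>N. norm (lincomb e a {..<N} - lincomb e a G)) \<longlonglongrightarrow> norm (x - lincomb e a G)"
      by (intro tendsto_intros partial)
    obtain N0 where N0: "G \<union> A \<subseteq> {..<N0}"
      using finite_nat_iff_bounded[of "G \<union> A"] G(1) \<open>finite A\<close> by blast
    show "\<forall>\<^sub>F N in sequentially. norm (lincomb e a {..<N} - lincomb e a G)
        \<le> C\<^sup>2 * norm (lincomb e a {..<N} - lincomb e c A)"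
      unfolding eventually_sequentially
    proof (intro exI allI impI)
      fix N assume "N0 \<le> N"
      then show "norm (lincomb e a {..<N} - lincomb e a G)
          \<le> C\<^sup>2 * norm (lincomb e a {..<N} - lincomb e c A)"
        using N0 that(2) G \<open>G \<noteq> {}\<close>
        by (intro property_Q_star_greedy_finite[OF basis(1) Q]) auto
    qed
  qed simp
  \<comment> \<open>With the constant moved to the left, the quotient is a lower bound for all
    distances and hence for both infima.\<close>
  have "norm (x - greedy_sum e m x) / C\<^sup>2 \<le> sigma_error e m x"
    unfolding sigma_error_def
  proof (rule cInf_greatest)
    show "{infdist x (span (e ` A)) |A. finite A \<and> card A = m} \<noteq> {}"
      using G by blast
    fix d assume "d \<in> {infdist x (span (e ` A)) |A. finite A \<and> card A = m}"
    then obtain A where A: "finite A" "card A = m" "d = infdist x (span (e ` A))" by blast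
    have ne: "span (e ` A) \<noteq> {}" using span_zero by blast
    show "norm (x - greedy_sum e m x) / C\<^sup>2 \<le> d"
      unfolding A(3) infdist_notempty[OF ne]
    proof (rule cINF_greatest[OF ne])
      fix w assume "w \<in> span (e ` A)"
      then obtain c where "w = lincomb e c A"
        using span_image_eq_lincomb[OF A(1)] by blast
      then show "norm (x - greedy_sum e m x) / C\<^sup>2 \<le> dist x w"
        using le[OF A(1,2), of c] \<open>C > 0\<close> G(3) by (simp add: dist_norm field_simps)
    qed
  qed
  then show ?thesis using \<open>C > 0\<close> by (simp add: field_simps)
qed

theorem theorem3p6:
  fixes e :: "nat \<Rightarrow> 'a::banach"
  assumes "schauder_basis e" and "semi_normalized e"
  shows "(\<forall>C::real. C > 0 \<longrightarrow>
            (\<forall>x. \<forall>m\<ge>1. norm (x - greedy_sum e m x) \<le> C * D_star_error e m x) \<longrightarrow>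
            property_Q_star e C) \<and>
         (\<forall>C::real. property_Q_star e C \<longrightarrow>
            (\<forall>x. \<forall>m\<ge>1. norm (x - greedy_sum e m x) \<le> C\<^sup>2 * sigma_error e m x))"
  using greedy_imp_property_Q_star[OF assms] property_Q_star_imp_greedy[OF assms] by blast

end
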